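(* Let $F$ be a 4-regular multigraph with Euler systems $C$ and $C'$. Then the relative interlacement matrices satisfy $$\mathcal{I}_{C'}(C)^{-1}=\mathcal{I}_{C}(C')$$ (in particular, $\mathcal{I}_{C'}(C)$ is invertible over $GF(2)$).
   Context: Multigraphs are finite; in a 4-regular multigraph every vertex has degree 4, and loops and parallel edges are allowed (a loop contributes 2 to the degree of its vertex). Each edge consists of two half-edges, so exactly four half-edges are incident at each vertex. A transition at a vertex $v$ is one of the three ways to sort the four half-edges at $v$ into two disjoint pairs. A circuit is a closed walk with no repeated edge; circuits are considered without preferred starting point or orientation. Choosing one transition at each vertex of $F$ yields a partition of the edge set $E(F)$ into edge-disjoint circuits (consecutive half-edges of a circuit passing through a vertex are those paired by the chosen transition); such a partition, together with its transitions, is a circuit partition $P$ of $F$, and $P$ is said to involve the chosen transition at each vertex. An Euler system is a circuit partition containing exactly one circuit (an Euler circuit, containing every edge of the component) for each connected component of $F$. Interlacement: given an Euler system $C$, two vertices $v\neq w$ are interlaced with respect to $C$ if they appear in the order $v\ldots w\ldots v\ldots w$ on one of the circuits of $C$. The interlacement matrix $\mathcal{I}(C)$ is the $V(F)\times V(F)$ zero-diagonal symmetric matrix over $GF(2)$ whose $vw$ entry ($v\neq w$) is $1$ if and only if $v$ and $w$ are interlaced with respect to $C$. Transition labels with respect to $C$: at a vertex $v$, orient the circuit of $C$ incident at $v$ (either way). The transition followed by $C$ at $v$ is labeled $\phi$; the other transition in which in-directed half-edges are paired with out-directed half-edges is labeled $\chi$; the transition in which the two in-directed half-edges are paired with each other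 and the two out-directed half-edges are paired with each other is labeled $\psi$. Relative interlacement matrix: for a circuit partition $P$ (for instance an Euler system) and an Euler system $C$ of $F$, $\mathcal{I}_P(C)$ is obtained from $\mathcal{I}(C)$ as follows, all labels being with respect to $C$. If $P$ involves the $\phi$ transition at $v$, change every nonzero entry of the row and column corresponding to $v$ to $0$, and change the diagonal entry of $v$ from $0$ to $1$. If $P$ involves the $\psi$ transition at $v$, change the diagonal entry of $v$ from $0$ to $1$. (No change on account of vertices where $P$ involves the $\chi$ transition.) Thus $\mathcal{I}_{C}(C')$ is formed using the interlacement matrix $\mathcal{I}(C')$ and the transition labels with respect to $C'$. *)

theory Defs
  imports "HOL-Analysis.Analysis" "HOL-Library.Z2"
begin

text \<open>
  A finite multigraph is given by its vertices (the type \<open>'v\<close>), its half-edges (the type \<open>'h\<close>),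
  the vertex at which each half-edge is incident, and the involution exchanging the two
  half-edges of an edge. A loop is an edge whose two half-edges share their vertex, so it
  contributes 2 to the degree.
\<close>

record ('v, 'h) multigraph =
  vert :: "'h \<Rightarrow> 'v"
  mate :: "'h \<Rightarrow> 'h"

definition is_multigraph :: "('v::finite, 'h::finite) multigraph \<Rightarrow> bool" where
  "is_multigraph F \<longleftrightarrow> (\<forall>h. mate F (mate F h) = h \<and> mate F h \<noteq> h)"

definition half_edges_at :: "('v, 'h) multigraph \<Rightarrow> 'v \<Rightarrow> 'h set" where
  "half_edges_at F v = {h. vert F h = v}"

definition four_regular :: "('v::finite, 'h::finite) multigraph \<Rightarrow> bool" where
  "four_regular F \<longleftrightarrow> is_multigraph F \<and> (\<forall>v. card (half_edges_at F v) = 4)"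

definition full_edge :: "('v, 'h) multigraph \<Rightarrow> 'h \<Rightarrow> 'h set" where
  "full_edge F h = {h, mate F h}"

definition graph_components :: "('v, 'h) multigraph \<Rightarrow> 'v set set" where
  "graph_components F = UNIV // {(vert F h, vert F (mate F h)) | h. True}\<^sup>*"

definition is_transition :: "('v, 'h) multigraph \<Rightarrow> 'v \<Rightarrow> 'h set set \<Rightarrow> bool" where
  "is_transition F v T \<longleftrightarrow>
     (\<exists>p q. T = {p, q} \<and> p \<inter> q = {} \<and> p \<union> q = half_edges_at F v \<and> card p = 2 \<and> card q = 2)"

text \<open>
  A closed walk without repeated edges, with a starting point and an orientation, is the list of
  half-edges along which it leaves its successive vertices: it traverses the \<open>i\<close>-th edge from
  \<open>c ! i\<close> to \<open>mate F (c ! i)\<close> and then leaves along the (cyclically) next entry of \<open>c\<close>.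
  A circuit is a class of such lists modulo rotation and reversal.
\<close>

definition closed_trail :: "('v, 'h) multigraph \<Rightarrow> 'h list \<Rightarrow> bool" where
  "closed_trail F c \<longleftrightarrow> c \<noteq> [] \<and> distinct (map (full_edge F) c) \<and>
     (\<forall>i < length c. vert F (mate F (c ! i)) = vert F (c ! (Suc i mod length c)))"

definition same_circuit :: "('v, 'h) multigraph \<Rightarrow> ('h list \<times> 'h list) set" where
  "same_circuit F = {(c, d). closed_trail F c \<and> closed_trail F d \<and>
     (\<exists>k. d = rotate k c \<or> d = rotate k (rev (map (mate F) c)))}"

text \<open>
  A circuit partition is represented by the transition \<open>P v\<close> it involves at each vertex \<open>v\<close>;
  these transitions determine its circuits.
\<close>

definition circuit_partition :: "('v, 'h) multigraph \<Rightarrow> ('v \<Rightarrow> 'h set set) \<Rightarrow> bool" where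
  "circuit_partition F P \<longleftrightarrow> (\<forall>v. is_transition F v (P v))"

definition follows :: "('v, 'h) multigraph \<Rightarrow> ('v \<Rightarrow> 'h set set) \<Rightarrow> 'h list \<Rightarrow> bool" where
  "follows F P c \<longleftrightarrow> closed_trail F c \<and>
     (\<forall>i < length c. {mate F (c ! i), c ! (Suc i mod length c)}
                       \<in> P (vert F (c ! (Suc i mod length c))))"

definition circuits :: "('v, 'h) multigraph \<Rightarrow> ('v \<Rightarrow> 'h set set) \<Rightarrow> 'h list set set" where
  "circuits F P = {c. follows F P c} // same_circuit F"

definition circuit_verts :: "('v, 'h) multigraph \<Rightarrow> 'h list set \<Rightarrow> 'v set" where
  "circuit_verts F Z = (\<Union>c\<in>Z. vert F ` set c)"

definition euler_system :: "('v, 'h) multigraph \<Rightarrow> ('v \<Rightarrow> 'h set set) \<Rightarrow> bool" where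
  "euler_system F C \<longleftrightarrow> circuit_partition F C \<and>
     (\<forall>K \<in> graph_components F. \<exists>!Z. Z \<in> circuits F C \<and> circuit_verts F Z \<subseteq> K)"

text \<open>
  Below, \<open>c \<in> Z\<close> chooses a starting point and an orientation of the circuit \<open>Z\<close>.
\<close>

definition interlaced :: "('v, 'h) multigraph \<Rightarrow> ('v \<Rightarrow> 'h set set) \<Rightarrow> 'v \<Rightarrow> 'v \<Rightarrow> bool" where
  "interlaced F C v w \<longleftrightarrow> v \<noteq> w \<and>
     (\<exists>Z \<in> circuits F C. \<exists>c \<in> Z. \<exists>i j k l. i < j \<and> j < k \<and> k < l \<and> l < length c \<and>
        vert F (c ! i) = v \<and> vert F (c ! j) = w \<and> vert F (c ! k) = v \<and> vert F (c ! l) = w)"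

definition interlacement_matrix ::
    "('v::finite, 'h) multigraph \<Rightarrow> ('v \<Rightarrow> 'h set set) \<Rightarrow> bit ^ 'v ^ 'v" where
  "interlacement_matrix F C = (\<chi> v w. if interlaced F C v w then 1 else 0)"

definition in_half_edges :: "('v, 'h) multigraph \<Rightarrow> 'h list \<Rightarrow> 'v \<Rightarrow> 'h set" where
  "in_half_edges F c v = mate F ` set c \<inter> half_edges_at F v"

definition out_half_edges :: "('v, 'h) multigraph \<Rightarrow> 'h list \<Rightarrow> 'v \<Rightarrow> 'h set" where
  "out_half_edges F c v = set c \<inter> half_edges_at F v"

text \<open>
  Labels of a transition \<open>T\<close> at \<open>v\<close> with respect to an Euler system \<open>C\<close>.
\<close>

definition phi_transition ::
    "('v, 'h) multigraph \<Rightarrow> ('v \<Rightarrow> 'h set set) \<Rightarrow> 'v \<Rightarrow> 'h set set \<Rightarrow> bool" where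
  "phi_transition F C v T \<longleftrightarrow> T = C v"

definition chi_transition ::
    "('v, 'h) multigraph \<Rightarrow> ('v \<Rightarrow> 'h set set) \<Rightarrow> 'v \<Rightarrow> 'h set set \<Rightarrow> bool" where
  "chi_transition F C v T \<longleftrightarrow> is_transition F v T \<and> T \<noteq> C v \<and>
     (\<exists>Z \<in> circuits F C. v \<in> circuit_verts F Z \<and>
        (\<exists>c \<in> Z. \<forall>p \<in> T. \<exists>a \<in> in_half_edges F c v. \<exists>b \<in> out_half_edges F c v. p = {a, b}))"

definition psi_transition ::
    "('v, 'h) multigraph \<Rightarrow> ('v \<Rightarrow> 'h set set) \<Rightarrow> 'v \<Rightarrow> 'h set set \<Rightarrow> bool" where
  "psi_transition F C v T \<longleftrightarrow>
     (\<exists>Z \<in> circuits F C. v \<in> circuit_verts F Z \<and>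
        (\<exists>c \<in> Z. T = {in_half_edges F c v, out_half_edges F c v}))"

text \<open>
  The matrix \<open>\<I>\<^sub>P(C)\<close>. A vertex where \<open>P\<close> involves the \<open>chi\<close> transition causes no change, so
  \<open>chi_transition\<close> does not occur in the formula.
\<close>

definition relative_interlacement_matrix ::
    "('v::finite, 'h) multigraph \<Rightarrow> ('v \<Rightarrow> 'h set set) \<Rightarrow> ('v \<Rightarrow> 'h set set) \<Rightarrow> bit ^ 'v ^ 'v" where
  "relative_interlacement_matrix F P C = (\<chi> v w.
     if v = w \<and> (phi_transition F C v (P v) \<or> psi_transition F C v (P v)) then 1
     else if phi_transition F C v (P v) \<or> phi_transition F C w (P w) then 0
     else interlacement_matrix F C $ v $ w)"

end

theory Submission
  imports Defs
begin

text \<open>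
  Fix an Euler system \<open>C\<close> and a vertex \<open>v\<close>. The part of the Euler circuit through \<open>v\<close> between its two
  visits to \<open>v\<close> is a closed walk; let \<open>X v\<close> be the set of its half-edges. At a vertex \<open>w \<noteq> v\<close> this set
  contains one pair of the transition \<open>C w\<close> if \<open>v\<close> and \<open>w\<close> are interlaced, and none or all of the
  half-edges otherwise; at \<open>v\<close> itself it consists of one pair of the \<open>chi\<close> transition
  (\<open>euler_system_fundamental_cycle\<close>). So the sets \<open>X v\<close> encode both the interlacement matrix and the
  labels.

  At every vertex pair two sets of half-edges by the parity of their intersection. Modulo complements
  the even sets of half-edges at a vertex form a symplectic plane over the field with two elements,
  whose three nonzero vectors are the three transitions. If \<open>X\<close> comes from \<open>C\<close> and \<open>Y\<close> from \<open>C'\<close>, then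
  the pairings of \<open>X v\<close> and \<open>Y u\<close> add up to zero over all vertices, because the intersection is a set
  of whole edges. With the interlacement matrices \<open>A\<close>, \<open>B\<close> and the local pairings
  \<open>d = \<langle>phi, phi'\<rangle>\<close>, \<open>e = \<langle>chi, phi'\<rangle>\<close>, \<open>f = \<langle>phi, chi'\<rangle>\<close>, \<open>g = \<langle>chi, chi'\<rangle>\<close>, where \<open>phi\<close>, \<open>chi\<close> are the
  transitions so labelled by \<open>C\<close> and \<open>phi'\<close>, \<open>chi'\<close> those so labelled by \<open>C'\<close>, this reads
  \<open>(\<Sum>w. A v w * B u w * d w) + A v u * f u + B u v * e v + \<delta> v u * g v = 0\<close>
  (\<open>euler_cycle_bases_orthogonal\<close>). For \<open>C = C'\<close> it gives the symmetry of \<open>A\<close>.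

  The entries of the two relative matrices are \<open>\<delta> v w * e v + d v * d w * A v w\<close> and
  \<open>\<delta> w u * f w + d w * d u * B w u\<close>. Multiplying them and inserting the orthogonality relation leaves
  \<open>\<delta> v u * (d v * g v + e v * f v)\<close>, and \<open>d v * g v + e v * f v = 1\<close> is the Pluecker relation in the
  symplectic plane at \<open>v\<close> (\<open>pairing_pluecker\<close>). Hence the product is the identity matrix.
\<close>

section \<open>Circuits followed by a circuit partition\<close>

text \<open>Both half-edges of each edge that a walk traverses.\<close>

definition trail_half_edges :: "('v, 'h) multigraph \<Rightarrow> 'h list \<Rightarrow> 'h set" where
  "trail_half_edges F c = set c \<union> mate F ` set c"

lemma transition_partner:
  assumes "is_transition F v T" and "vert F h = v"
  shows "\<exists>!k. k \<noteq> h \<and> {h, k} \<in> T"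
proof -
  obtain p q where T: "T = {p, q}" "p \<inter> q = {}" "p \<union> q = half_edges_at F v" "card p = 2" "card q = 2"
    using assms(1) unfolding is_transition_def by blast
  have "h \<in> p \<union> q" using assms(2) T(3) by (simp add: half_edges_at_def)
  obtain a b where ab: "p = {a, b}" "a \<noteq> b" using T(4) by (meson card_2_iff)
  obtain c d where cd: "q = {c, d}" "c \<noteq> d" using T(5) by (meson card_2_iff)
  show ?thesis
    using \<open>h \<in> p \<union> q\<close> T(1,2) ab cd by (auto simp: doubleton_eq_iff)
qed

lemma transition_pair_vert:
  assumes "is_transition F v T" and "p \<in> T" and "h \<in> p"
  shows "vert F h = v"
  using assms unfolding is_transition_def half_edges_at_def by blast

lemma transition_pair_ne:
  assumes "is_transition F v T" and "{h, k} \<in> T"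
  shows "h \<noteq> k"
  using assms unfolding is_transition_def by auto

text \<open>
  The half-edge along which the circuit of \<open>P\<close> that leaves a vertex along \<open>h\<close> leaves the next vertex.
\<close>

definition next_half_edge :: "('v, 'h) multigraph \<Rightarrow> ('v \<Rightarrow> 'h set set) \<Rightarrow> 'h \<Rightarrow> 'h" where
  "next_half_edge F P h =
     (THE k. k \<noteq> mate F h \<and> {mate F h, k} \<in> P (vert F (mate F h)))"

lemma next_half_edge:
  assumes "circuit_partition F P"
  shows "next_half_edge F P h \<noteq> mate F h"
    and "{mate F h, next_half_edge F P h} \<in> P (vert F (mate F h))"
    and "vert F (next_half_edge F P h) = vert F (mate F h)"
proof -
  have tr: "is_transition F (vert F (mate F h)) (P (vert F (mate F h)))"
    using assms by (simp add: circuit_partition_def)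
  have *: "next_half_edge F P h \<noteq> mate F h \<and>
      {mate F h, next_half_edge F P h} \<in> P (vert F (mate F h))"
    unfolding next_half_edge_def by (rule theI') (rule transition_partner[OF tr refl])
  then show "next_half_edge F P h \<noteq> mate F h"
    and "{mate F h, next_half_edge F P h} \<in> P (vert F (mate F h))" by auto
  then show "vert F (next_half_edge F P h) = vert F (mate F h)"
    using transition_pair_vert[OF tr] by blast
qed

lemma next_half_edge_eqI:
  assumes "circuit_partition F P" and "{mate F h, k} \<in> P (vert F (mate F h))"
  shows "next_half_edge F P h = k"
proof -
  have tr: "is_transition F (vert F (mate F h)) (P (vert F (mate F h)))"
    using assms by (simp add: circuit_partition_def)
  show ?thesis
    using transition_partner[OF tr refl] transition_pair_ne[OF tr assms(2)] assms(2)
      next_half_edge[OF assms(1), of h] by metis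
qed

text \<open>Reversing an edge conjugates the step along a circuit into its inverse.\<close>

lemma next_half_edge_mate_next:
  assumes "is_multigraph F" and "circuit_partition F P"
  shows "next_half_edge F P (mate F (next_half_edge F P h)) = mate F h"
proof (rule next_half_edge_eqI[OF assms(2)])
  have "mate F (mate F (next_half_edge F P h)) = next_half_edge F P h"
    using assms(1) by (simp add: is_multigraph_def)
  then show "{mate F (mate F (next_half_edge F P h)), mate F h}
      \<in> P (vert F (mate F (mate F (next_half_edge F P h))))"
    using next_half_edge[OF assms(2), of h] by (simp add: insert_commute)
qed

lemma inj_next_half_edge:
  assumes "is_multigraph F" and "circuit_partition F P"
  shows "inj (next_half_edge F P)"
proof (rule injI)
  fix x y assume "next_half_edge F P x = next_half_edge F P y"
  then have "mate F x = mate F y"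
    using next_half_edge_mate_next[OF assms] by metis
  then show "x = y" using assms(1) unfolding is_multigraph_def by metis
qed

text \<open>
  A walk following the transitions never returns along an edge it has used: otherwise, shrinking
  the walk from both ends, some half-edge would be its own mate or its own partner in a transition.
\<close>

lemma funpow_next_half_edge_ne_mate:
  assumes "is_multigraph F" and "circuit_partition F P"
  shows "(next_half_edge F P ^^ n) x \<noteq> mate F x"
proof (induction n arbitrary: x rule: less_induct)
  case (less n)
  let ?s = "next_half_edge F P"
  consider "n = 0" | "n = 1" | m where "n = Suc (Suc m)"
    by (metis One_nat_def not0_implies_Suc)
  then show ?case
  proof cases
    case 1
    then show ?thesis using assms(1) unfolding is_multigraph_def by (metis funpow_0)
  next
    case 2
    then show ?thesis using next_half_edge(1)[OF assms(2)] by simp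
  next
    case 3
    show ?thesis
    proof
      assume eq: "(?s ^^ n) x = mate F x"
      have "?s ((?s ^^ m) (?s x)) = (?s ^^ n) x"
        using 3 by (simp add: funpow_swap1)
      also have "\<dots> = ?s (mate F (?s x))"
        using eq next_half_edge_mate_next[OF assms] by simp
      finally have "(?s ^^ m) (?s x) = mate F (?s x)"
        using inj_next_half_edge[OF assms] by (simp add: inj_def)
      then show False using less.IH[of m "?s x"] 3 by simp
    qed
  qed
qed

text \<open>
  The circuit through a half-edge is its orbit under the permutation \<open>next_half_edge F P\<close>.
\<close>

lemma exists_following_trail:
  fixes F :: "('v::finite, 'h::finite) multigraph"
  assumes "is_multigraph F" and "circuit_partition F P"
  obtains c where "follows F P (h # c)"
proof -
  let ?s = "next_half_edge F P"
  have inj: "inj ?s" by (rule inj_next_half_edge[OF assms])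
  have "\<exists>n>0. (?s ^^ n) h = h"
    using funpow_inj_finite[OF inj, of h] by (metis finite)
  define k where "k = (LEAST n. n > 0 \<and> (?s ^^ n) h = h)"
  have k: "k > 0" "(?s ^^ k) h = h"
    using LeastI_ex[OF \<open>\<exists>n>0. (?s ^^ n) h = h\<close>] by (auto simp: k_def)
  have kmin: "\<not> (n > 0 \<and> (?s ^^ n) h = h)" if "n < k" for n
    using not_less_Least that unfolding k_def by blast
  define c where "c = map (\<lambda>i. (?s ^^ i) h) [0..<k]"
  have len: "length c = k" by (simp add: c_def)
  have nth: "c ! i = (?s ^^ i) h" if "i < k" for i using that by (simp add: c_def)
  have nxt: "c ! (Suc i mod k) = ?s (c ! i)" if "i < k" for i
  proof (cases "Suc i = k")
    case True
    then have "?s ((?s ^^ i) h) = h" using k(2) by auto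
    then show ?thesis using True k(1) nth[of i] nth[of 0] that by simp
  next
    case False
    then have "Suc i < k" using that by simp
    then show ?thesis using nth that by simp
  qed
  have ne: "full_edge F (c ! i) \<noteq> full_edge F (c ! j)" if "i < j" "j < k" for i j
  proof
    assume eq: "full_edge F (c ! i) = full_edge F (c ! j)"
    have shift: "c ! j = (?s ^^ (j - i)) (c ! i)"
      using that nth funpow_add[of "j - i" i ?s] by simp
    from eq consider "c ! j = c ! i" | "c ! j = mate F (c ! i)"
      unfolding full_edge_def by (auto simp: doubleton_eq_iff)
    then show False
    proof cases
      case 1
      have "(?s ^^ i) ((?s ^^ (j - i)) h) = (?s ^^ j) h"
        using that funpow_add[of i "j - i" ?s] by simp
      also have "\<dots> = (?s ^^ i) h" using 1 nth that by simp
      finally have "(?s ^^ (j - i)) h = h"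
        using inj_fn[OF inj, of i] by (simp add: inj_def)
      then show False using kmin[of "j - i"] that by fastforce
    next
      case 2
      then show False using shift funpow_next_half_edge_ne_mate[OF assms] by metis
    qed
  qed
  have "distinct (map (full_edge F) c)"
    unfolding distinct_conv_nth
  proof (intro allI impI)
    fix i j
    assume "i < length (map (full_edge F) c)" "j < length (map (full_edge F) c)" "i \<noteq> j"
    then show "map (full_edge F) c ! i \<noteq> map (full_edge F) c ! j"
      using ne[of i j] ne[of j i] len by (cases i j rule: linorder_cases) auto
  qed
  moreover have "c \<noteq> []" using k(1) len by auto
  ultimately have "follows F P c"
    unfolding follows_def closed_trail_def
    using nxt len next_half_edge[OF assms(2)] by auto
  moreover have "c = h # tl c"
    using nth[OF k(1)] \<open>c \<noteq> []\<close> by (cases c) auto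
  ultimately show thesis using that by metis
qed

section \<open>Rotation and reversal\<close>

text \<open>
  Listing the vertices at which the edges of a closed trail arrive shifts the list of its vertices
  by one; so reversing the trail reverses the cyclic sequence of its vertices.
\<close>

lemma closed_trail_map_vert_mate:
  assumes "closed_trail F c"
  shows "map (\<lambda>h. vert F (mate F h)) c = rotate1 (map (vert F) c)"
proof (rule nth_equalityI)
  fix i assume "i < length (map (\<lambda>h. vert F (mate F h)) c)"
  then have i: "i < length c" by simp
  then have "Suc i mod length c < length c" by (intro mod_less_divisor) auto
  then show "map (\<lambda>h. vert F (mate F h)) c ! i = rotate1 (map (vert F) c) ! i"
    using assms i by (simp add: closed_trail_def nth_rotate1)
qed simp

lemma closed_trail_reverse_verts:
  assumes "closed_trail F c"
  shows "map (vert F) (rev (map (mate F) c)) = rev (rotate1 (map (vert F) c))"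
  unfolding closed_trail_map_vert_mate[OF assms, symmetric] by (simp add: rev_map comp_def)

lemma same_circuit_refl: "closed_trail F c \<Longrightarrow> (c, c) \<in> same_circuit F"
  unfolding same_circuit_def by (auto intro!: exI[of _ 0])

lemma same_circuit_verts:
  assumes "(c, d) \<in> same_circuit F"
  shows "vert F ` set d = vert F ` set c"
proof -
  from assms obtain k where c: "closed_trail F c"
    and "d = rotate k c \<or> d = rotate k (rev (map (mate F) c))"
    unfolding same_circuit_def by auto
  moreover have "vert F ` mate F ` set c = vert F ` set c"
    using arg_cong[OF closed_trail_map_vert_mate[OF c], of set] by (simp add: image_image)
  ultimately show ?thesis by auto
qed

lemma same_circuit_sets:
  assumes "is_multigraph F" and "(c, d) \<in> same_circuit F"
  shows "set d = set c \<and> mate F ` set d = mate F ` set c \<or>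
    set d = mate F ` set c \<and> mate F ` set d = set c"
proof -
  obtain k where "d = rotate k c \<or> d = rotate k (rev (map (mate F) c))"
    using assms(2) unfolding same_circuit_def by auto
  then have "set d = set c \<or> set d = mate F ` set c" by auto
  moreover have "mate F ` mate F ` set c = set c"
    using assms(1) by (simp add: is_multigraph_def image_image)
  ultimately show ?thesis by metis
qed

lemma same_circuit_half_edges:
  assumes "is_multigraph F" and "(c, d) \<in> same_circuit F"
  shows "trail_half_edges F d = trail_half_edges F c"
  using same_circuit_sets[OF assms] unfolding trail_half_edges_def
  by (elim disjE) auto

text \<open>Reversing a circuit exchanges its in-directed and its out-directed half-edges.\<close>

lemma same_circuit_in_out:
  assumes "is_multigraph F" and "(c, d) \<in> same_circuit F"
  shows "{in_half_edges F d v, out_half_edges F d v} = {in_half_edges F c v, out_half_edges F c v}"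
  using same_circuit_sets[OF assms] unfolding in_half_edges_def out_half_edges_def
  by (elim disjE conjE) (simp_all add: insert_commute)

section \<open>Euler systems\<close>

lemma closed_trail_reachable:
  assumes "closed_trail F c" and "h \<in> set c" and "k \<in> set c"
  shows "(vert F h, vert F k) \<in> {(vert F h, vert F (mate F h)) | h. True}\<^sup>*"
proof -
  let ?R = "{(vert F h, vert F (mate F h)) | h. True}\<^sup>*" and ?n = "length c"
  obtain i where i: "i < ?n" "c ! i = h" using assms(2) by (meson in_set_conv_nth)
  obtain j where j: "j < ?n" "c ! j = k" using assms(3) by (meson in_set_conv_nth)
  have step: "(vert F (c ! i), vert F (c ! ((i + t) mod ?n))) \<in> ?R" for t
  proof (induction t)
    case 0
    then show ?case using i by simp
  next
    case (Suc t)
    let ?m = "(i + t) mod ?n"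
    have "?m < ?n" using i by (intro mod_less_divisor) auto
    then have "vert F (mate F (c ! ?m)) = vert F (c ! ((i + Suc t) mod ?n))"
      using assms(1) by (simp add: closed_trail_def mod_Suc_eq)
    then have "(vert F (c ! ?m), vert F (c ! ((i + Suc t) mod ?n)))
        \<in> {(vert F h, vert F (mate F h)) | h. True}" by auto
    then show ?case using Suc.IH by (rule rtrancl_into_rtrancl[rotated])
  qed
  have "(i + (j + ?n - i)) mod ?n = j" using i j by simp
  then show ?thesis using step[of "j + ?n - i"] i j by simp
qed

lemma circuitsE:
  assumes "Z \<in> circuits F P"
  obtains c where "follows F P c" and "Z = same_circuit F `` {c}"
  using assms unfolding circuits_def quotient_def by auto

lemma circuit_half_edges:
  assumes "is_multigraph F" and "Z \<in> circuits F P" and "c \<in> Z" and "d \<in> Z"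
  shows "trail_half_edges F c = trail_half_edges F d"
proof -
  obtain e where "Z = same_circuit F `` {e}" using circuitsE[OF assms(2)] by metis
  then show ?thesis
    using assms(3,4) same_circuit_half_edges[OF assms(1)] by (metis Image_singleton_iff)
qed

lemma circuit_verts_eq:
  assumes "Z \<in> circuits F P" and "c \<in> Z"
  shows "circuit_verts F Z = vert F ` set c"
proof -
  obtain d where d: "Z = same_circuit F `` {d}" using circuitsE[OF assms(1)] by metis
  have "vert F ` set e = vert F ` set d" if "e \<in> Z" for e
    using that same_circuit_verts d by (metis Image_singleton_iff)
  then show ?thesis using assms(2) unfolding circuit_verts_def by blast
qed

text \<open>
  A closed trail stays in the component of any of its vertices, and this component contains only one
  circuit of an Euler system.
\<close>

lemma euler_circuit_unique:
  assumes "euler_system F C" and "Z \<in> circuits F C" and "Z' \<in> circuits F C"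
    and "v \<in> circuit_verts F Z" and "v \<in> circuit_verts F Z'"
  shows "Z = Z'"
proof -
  define K where "K = {(vert F h, vert F (mate F h)) | h. True}\<^sup>* `` {v}"
  have sub: "circuit_verts F Y \<subseteq> K"
    if Y: "Y \<in> circuits F C" "v \<in> circuit_verts F Y" for Y
  proof -
    obtain c where "follows F C c" "Y = same_circuit F `` {c}"
      using circuitsE[OF Y(1)] by blast
    then have c: "c \<in> Y" "closed_trail F c"
      using same_circuit_refl by (auto simp: follows_def)
    have eq: "circuit_verts F Y = vert F ` set c" by (rule circuit_verts_eq[OF Y(1) c(1)])
    then obtain h where h: "h \<in> set c" "v = vert F h" using Y(2) by auto
    show ?thesis
    proof
      fix w assume "w \<in> circuit_verts F Y"
      then obtain k where "k \<in> set c" "w = vert F k" using eq by auto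
      then show "w \<in> K" using closed_trail_reachable[OF c(2) h(1)] h(2) by (simp add: K_def)
    qed
  qed
  have "K \<in> graph_components F"
    unfolding graph_components_def K_def by (rule quotientI) simp
  then have "\<exists>!Y. Y \<in> circuits F C \<and> circuit_verts F Y \<subseteq> K"
    using assms(1) unfolding euler_system_def by (elim conjE) (rule bspec)
  moreover have "circuit_verts F Z \<subseteq> K" "circuit_verts F Z' \<subseteq> K"
    using sub[OF assms(2,4)] sub[OF assms(3,5)] by auto
  ultimately show ?thesis using assms(2,3) by blast
qed

lemma euler_circuit_at:
  fixes F :: "('v::finite, 'h::finite) multigraph"
  assumes "is_multigraph F" and "euler_system F C"
  obtains c where "follows F C (h # c)" and "same_circuit F `` {h # c} \<in> circuits F C"
    and "h # c \<in> same_circuit F `` {h # c}"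
proof -
  obtain c where c: "follows F C (h # c)"
    using exists_following_trail[OF assms(1), of C h] assms(2) by (auto simp: euler_system_def)
  moreover have "same_circuit F `` {h # c} \<in> circuits F C"
    unfolding circuits_def using c by (intro quotientI) simp
  moreover have "h # c \<in> same_circuit F `` {h # c}"
    using c same_circuit_refl by (auto simp: follows_def)
  ultimately show thesis by (rule that)
qed

lemma euler_circuit_covers:
  fixes F :: "('v::finite, 'h::finite) multigraph"
  assumes "is_multigraph F" and "euler_system F C"
    and "Z \<in> circuits F C" and "c \<in> Z" and "w \<in> vert F ` set c"
  shows "half_edges_at F w \<subseteq> trail_half_edges F c"
proof
  fix h assume h: "h \<in> half_edges_at F w"
  obtain d where d: "same_circuit F `` {h # d} \<in> circuits F C"
      "h # d \<in> same_circuit F `` {h # d}"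
    using euler_circuit_at[OF assms(1,2)] by metis
  have "w \<in> circuit_verts F (same_circuit F `` {h # d})"
    using circuit_verts_eq[OF d] h by (simp add: half_edges_at_def)
  moreover have "w \<in> circuit_verts F Z" using circuit_verts_eq[OF assms(3,4)] assms(5) by simp
  ultimately have "h # d \<in> Z" using euler_circuit_unique[OF assms(2,3) d(1)] d(2) by metis
  then show "h \<in> trail_half_edges F c"
    using circuit_half_edges[OF assms(1,3,4)] by (metis UnI1 list.set_intros(1) trail_half_edges_def)
qed

text \<open>
  An Euler circuit arrives at a vertex as often as it leaves it, and uses all four half-edges there.
\<close>

lemma euler_circuit_visits_twice:
  fixes F :: "('v::finite, 'h::finite) multigraph"
  assumes "four_regular F" and "euler_system F C"
    and "Z \<in> circuits F C" and "c \<in> Z" and "closed_trail F c" and "w \<in> vert F ` set c"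
  shows "count_list (map (vert F) c) w = 2"
    and "card (in_half_edges F c w) = 2" and "card (out_half_edges F c w) = 2"
    and "in_half_edges F c w \<inter> out_half_edges F c w = {}"
    and "in_half_edges F c w \<union> out_half_edges F c w = half_edges_at F w"
proof -
  have mg: "is_multigraph F" using assms(1) by (simp add: four_regular_def)
  have mm: "mate F (mate F h) = h" "mate F h \<noteq> h" for h
    using mg by (auto simp: is_multigraph_def)
  have inj_m: "inj_on (mate F) A" for A by (metis inj_onI mm(1))
  have dist_e: "distinct (map (full_edge F) c)" using assms(5) by (simp add: closed_trail_def)
  then have dist: "distinct c" and inj_e: "inj_on (full_edge F) (set c)"
    by (auto simp: distinct_map)
  have disj: "set c \<inter> mate F ` set c = {}"
  proof (rule ccontr)
    assume "set c \<inter> mate F ` set c \<noteq> {}"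
    then obtain x where x: "x \<in> set c" "mate F x \<in> set c" by blast
    moreover have "full_edge F x = full_edge F (mate F x)" using mm by (auto simp: full_edge_def)
    ultimately have "x = mate F x" using inj_e by (auto dest: inj_onD)
    then show False using mm by metis
  qed
  then show dj: "in_half_edges F c w \<inter> out_half_edges F c w = {}"
    by (auto simp: in_half_edges_def out_half_edges_def)
  show un: "in_half_edges F c w \<union> out_half_edges F c w = half_edges_at F w"
    using euler_circuit_covers[OF mg assms(2,3,4,6)]
    by (auto simp: in_half_edges_def out_half_edges_def trail_half_edges_def)
  have count: "count_list (map f c) w = card {h \<in> set c. f h = w}" for f
    using dist
  proof (induction c)
    case (Cons x c)
    have "{h \<in> set (x # c). f h = w} =
        (if f x = w then insert x {h \<in> set c. f h = w} else {h \<in> set c. f h = w})" by auto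
    then show ?case using Cons by simp
  qed simp
  have out: "card (out_half_edges F c w) = count_list (map (vert F) c) w"
    unfolding count by (auto simp: out_half_edges_def half_edges_at_def intro!: arg_cong[of _ _ card])
  have "in_half_edges F c w = mate F ` {h \<in> set c. vert F (mate F h) = w}"
    by (auto simp: in_half_edges_def half_edges_at_def)
  then have "card (in_half_edges F c w) = count_list (map (\<lambda>h. vert F (mate F h)) c) w"
    unfolding count using card_image[OF inj_m] by simp
  also have "\<dots> = count_list (map (vert F) c) w"
    unfolding closed_trail_map_vert_mate[OF assms(5)]
    by (cases c) auto
  finally have inn: "card (in_half_edges F c w) = count_list (map (vert F) c) w" .
  have "card (in_half_edges F c w) + card (out_half_edges F c w) = 4"
    using card_Un_disjoint[OF _ _ dj] un assms(1) by (simp add: four_regular_def)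
  then show "count_list (map (vert F) c) w = 2"
    "card (in_half_edges F c w) = 2" "card (out_half_edges F c w) = 2"
    using inn out by auto
qed

section \<open>Interlacement read off one representative\<close>

text \<open>
  For a list in which \<open>v\<close> and \<open>w\<close> both occur twice this says that they alternate cyclically.
\<close>

definition alternate :: "'a \<Rightarrow> 'a \<Rightarrow> 'a list \<Rightarrow> bool" where
  "alternate v w xs \<longleftrightarrow> filter (\<lambda>x. x = v \<or> x = w) xs \<in> {[v, w, v, w], [w, v, w, v]}"

lemma alternate_rotate1: "alternate v w (rotate1 xs) \<longleftrightarrow> alternate v w xs"
proof (cases xs)
  case (Cons x ys)
  have "filter P (ys @ [x]) = (if P x then filter P ys @ [x] else filter P ys)" for P
    by simp
  moreover have "zs @ [y] = [a, b, a, b] \<longleftrightarrow> y # zs = [b, a, b, a]" for zs y and a b :: 'a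
    by (auto simp: append_eq_Cons_conv)
  ultimately show ?thesis using Cons by (auto simp: alternate_def)
qed simp

lemma alternate_rotate: "alternate v w (rotate k xs) \<longleftrightarrow> alternate v w xs"
  by (induction k) (simp_all add: alternate_rotate1)

lemma alternate_rev: "alternate v w (rev xs) \<longleftrightarrow> alternate v w xs"
proof -
  have "rev zs = [a, b, a, b] \<longleftrightarrow> zs = [b, a, b, a]" for zs and a b :: 'a
    by (auto simp: rev_swap)
  then show ?thesis by (auto simp: alternate_def simp flip: rev_filter)
qed

lemma alternate_same_circuit:
  assumes "(c, d) \<in> same_circuit F"
  shows "alternate v w (map (vert F) d) \<longleftrightarrow> alternate v w (map (vert F) c)"
proof -
  from assms obtain k where c: "closed_trail F c"
    and d: "d = rotate k c \<or> d = rotate k (rev (map (mate F) c))"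
    unfolding same_circuit_def by auto
  then show ?thesis
    using closed_trail_reverse_verts[OF c]
    by (metis alternate_rotate alternate_rotate1 alternate_rev rotate_map)
qed

lemma alternateI_nth:
  assumes "i < j" "j < k" "k < l" "l < length xs"
    and "xs ! i = v" "xs ! j = w" "xs ! k = v" "xs ! l = w"
    and "v \<noteq> w" and "count_list xs v = 2" and "count_list xs w = 2"
  shows "alternate v w xs"
proof -
  have split: "\<exists>A B. ys = A @ ys ! n # B \<and> length A = n \<and> (\<forall>m > n. ys ! m = B ! (m - Suc n))"
    if "n < length ys" for n and ys :: "'a list"
    using that id_take_nth_drop[OF that]
    by (intro exI[of _ "take n ys"] exI[of _ "drop (Suc n) ys"]) auto
  obtain A X where X: "xs = A @ v # X" "length A = i" "\<forall>m > i. xs ! m = X ! (m - Suc i)"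
    using split[of i xs] assms by auto
  obtain B Y where Y: "X = B @ w # Y" "length B = j - Suc i"
      "\<forall>m > j - Suc i. X ! m = Y ! (m - Suc (j - Suc i))"
    using split[of "j - Suc i" X] X assms by force
  have Yn: "Y ! (m - Suc j) = xs ! m" if "m > j" for m
  proof -
    have "m - Suc i - Suc (j - Suc i) = m - Suc j" using that assms(1) by simp
    then show ?thesis using X(3) Y(3) that assms(1) by (metis diff_less_mono less_trans Suc_leI)
  qed
  obtain D E where D: "Y = D @ v # E" "length D = k - Suc j"
      "\<forall>m > k - Suc j. Y ! m = E ! (m - Suc (k - Suc j))"
    using split[of "k - Suc j" Y] X(1,2) Y(1,2) Yn[of k] assms by force
  have "E ! (l - Suc k) = w"
  proof -
    have "l - Suc j - Suc (k - Suc j) = l - Suc k" "l - Suc j > k - Suc j" using assms by auto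
    then show ?thesis using D(3) Yn[of l] assms by (metis less_trans)
  qed
  moreover have "l - Suc k < length E" using X(1,2) Y(1,2) D(1,2) assms by simp
  ultimately have "w \<in> set E" using nth_mem by metis
  then obtain G H where E: "E = G @ w # H" by (meson split_list)
  have xs: "xs = A @ v # B @ w # D @ v # G @ w # H" using X(1) Y(1) D(1) E by simp
  have "count_list ys x = 0 \<Longrightarrow> x \<notin> set ys" for x and ys :: "'a list"
    by (simp add: count_list_0_iff)
  then have "\<forall>ys \<in> {A, B, D, G, H}. v \<notin> set ys \<and> w \<notin> set ys"
    using assms(9-11) unfolding xs by auto
  then have "filter (\<lambda>x. x = v \<or> x = w) ys = []" if "ys \<in> {A, B, D, G, H}" for ys
    using that by (auto simp: filter_empty_conv)
  then have "filter (\<lambda>x. x = v \<or> x = w) xs = [v, w, v, w]" unfolding xs by simp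
  then show ?thesis by (simp add: alternate_def)
qed

text \<open>
  \<open>interlaced\<close> allows any starting point and direction of the circuit; alternation does not depend on
  this choice, so it can be tested on a representative that is fixed beforehand.
\<close>

lemma interlaced_imp_alternate:
  fixes F :: "('v::finite, 'h::finite) multigraph"
  assumes "four_regular F" and "euler_system F C"
    and "Z \<in> circuits F C" and "c \<in> Z" and "v \<in> vert F ` set c"
    and "v \<noteq> w" and "interlaced F C v w"
  shows "w \<in> vert F ` set c" and "alternate v w (map (vert F) c)"
proof -
  obtain Z' d i j k l where d: "Z' \<in> circuits F C" "d \<in> Z'"
    and ijkl: "i < j" "j < k" "k < l" "l < length d"
      "vert F (d ! i) = v" "vert F (d ! j) = w" "vert F (d ! k) = v" "vert F (d ! l) = w"
    using assms(7) unfolding interlaced_def by blast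
  have v: "v \<in> vert F ` set d" using ijkl nth_mem by (metis image_eqI less_trans)
  have w: "w \<in> vert F ` set d" using ijkl nth_mem by (metis image_eqI less_trans)
  have "v \<in> circuit_verts F Z" "v \<in> circuit_verts F Z'"
    using circuit_verts_eq[OF assms(3,4)] circuit_verts_eq[OF d] assms(5) v by auto
  then have dZ: "d \<in> Z" using euler_circuit_unique[OF assms(2,3) d(1)] d(2) by metis
  obtain e where e: "Z = same_circuit F `` {e}" using circuitsE[OF assms(3)] by metis
  then have d': "closed_trail F d" "(e, d) \<in> same_circuit F" "(e, c) \<in> same_circuit F"
    using dZ assms(4) by (auto simp: same_circuit_def)
  show "w \<in> vert F ` set c"
    using w same_circuit_verts[OF d'(2)] same_circuit_verts[OF d'(3)] by simp
  have "alternate v w (map (vert F) d)"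
    using euler_circuit_visits_twice(1)[OF assms(1,2,3) dZ d'(1)] v w ijkl assms(6)
    by (intro alternateI_nth[of i j k l]) auto
  then show "alternate v w (map (vert F) c)"
    using alternate_same_circuit[OF d'(2)] alternate_same_circuit[OF d'(3)] by simp
qed

section \<open>Fundamental cycles of an Euler system\<close>

lemma single_visit_split:
  assumes "count_list (map f c) w = Suc 0"
  obtains a g b where "c = a @ g # b" and "f g = w" and "w \<notin> f ` set a" and "w \<notin> f ` set b"
proof -
  obtain A B where AB: "map f c = A @ w # B" "w \<notin> set A" "count_list B w = 0"
    using count_list_Suc_split_first[OF assms] by auto
  then obtain a c' where c: "c = a @ c'" "A = map f a" "map f c' = w # B"
    by (auto simp: map_eq_append_conv)
  then obtain g b where "c' = g # b" "f g = w" "map f b = B" by auto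
  then show thesis using that[of a g b] c AB by (auto simp: count_list_0_iff)
qed

text \<open>A walk that leaves along \<open>x\<close> and next along \<open>y\<close> follows the transition at the vertex between.\<close>

definition transition_step :: "('v, 'h) multigraph \<Rightarrow> ('v \<Rightarrow> 'h set set) \<Rightarrow> 'h \<Rightarrow> 'h \<Rightarrow> bool" where
  "transition_step F C x y \<longleftrightarrow> {mate F x, y} \<in> C (vert F y)"

lemma transition_step_vert:
  assumes "circuit_partition F C" and "transition_step F C x y"
  shows "vert F (mate F x) = vert F y"
  using assms transition_pair_vert unfolding circuit_partition_def transition_step_def
  by (metis insertI1)

lemma follows_successively:
  assumes "follows F C c"
  shows "successively (transition_step F C) c" and "transition_step F C (last c) (hd c)"
proof -
  have step: "transition_step F C (c ! i) (c ! (Suc i mod length c))"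
    if "i < length c" for i
    using assms that by (auto simp: follows_def closed_trail_def transition_step_def)
  have "successively R xs" if "\<forall>i. Suc i < length xs \<longrightarrow> R (xs ! i) (xs ! Suc i)" for R and xs :: "'b list"
    using that
  proof (induction R xs rule: successively.induct)
    case (3 P x y xs)
    have "P x y" using "3.prems" by (metis length_Cons nth_Cons_0 nth_Cons_Suc Suc_less_eq zero_less_Suc)
    moreover have "\<forall>i. Suc i < length (y # xs) \<longrightarrow> P ((y # xs) ! i) ((y # xs) ! Suc i)"
      using "3.prems" by (metis length_Cons nth_Cons_Suc Suc_less_eq)
    ultimately show ?case using "3.IH" by simp
  qed auto
  moreover have "transition_step F C (c ! i) (c ! Suc i)" if "Suc i < length c" for i
    using step[of i] that by simp
  ultimately show "successively (transition_step F C) c" by blast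
  have "c \<noteq> []" using assms by (auto simp: follows_def closed_trail_def)
  then show "transition_step F C (last c) (hd c)"
    using step[of "length c - 1"] by (simp add: last_conv_nth hd_conv_nth)
qed

text \<open>
  The next two lemmas concern a segment of a walk that meets \<open>w\<close> at most in its first and in its
  last vertex.
\<close>

lemma segment_in_half_edges:
  assumes "circuit_partition F C" and "successively (transition_step F C) (h # a)"
    and "w \<notin> vert F ` set a"
  shows "mate F ` set (h # a) \<inter> half_edges_at F w =
    (if vert F (mate F (last (h # a))) = w then {mate F (last (h # a))} else {})"
  using assms(2,3)
proof (induction a arbitrary: h)
  case Nil
  then show ?case by (auto simp: half_edges_at_def)
next
  case (Cons g a)
  have "vert F (mate F h) \<noteq> w"
    using transition_step_vert[OF assms(1), of h g] Cons.prems by auto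
  then have "mate F ` set (h # g # a) \<inter> half_edges_at F w = mate F ` set (g # a) \<inter> half_edges_at F w"
    by (auto simp: half_edges_at_def)
  also have "\<dots> = (if vert F (mate F (last (g # a))) = w then {mate F (last (g # a))} else {})"
    using Cons.prems by (intro Cons.IH) auto
  finally show ?case by simp
qed

lemma segment_half_edges:
  assumes "circuit_partition F C" and "successively (transition_step F C) (h # a)"
    and "w \<notin> vert F ` set a"
  shows "trail_half_edges F (h # a) \<inter> half_edges_at F w =
    (if vert F h = w then {h} else {}) \<union>
    (if vert F (mate F (last (h # a))) = w then {mate F (last (h # a))} else {})"
proof -
  have "set (h # a) \<inter> half_edges_at F w = (if vert F h = w then {h} else {})"
  proof -
    have "vert F x \<noteq> w" if "x \<in> set a" for x using that assms(3) by blast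
    then show ?thesis by (auto simp: half_edges_at_def)
  qed
  then show ?thesis
    unfolding trail_half_edges_def Int_Un_distrib2 segment_in_half_edges[OF assms] by simp
qed

lemma trail_half_edges_append:
  "trail_half_edges F (a @ b) = trail_half_edges F a \<union> trail_half_edges F b"
  by (auto simp: trail_half_edges_def)

lemma transition_of_pair:
  assumes "is_transition F v T" and "p \<in> T"
  shows "T = {p, half_edges_at F v - p}"
proof -
  obtain q r where "T = {q, r}" "q \<inter> r = {}" "q \<union> r = half_edges_at F v"
    using assms(1) unfolding is_transition_def by blast
  then have "half_edges_at F v - q = r" "half_edges_at F v - r = q" by auto
  then show ?thesis using assms(2) \<open>T = {q, r}\<close> by auto
qed

text \<open>
  The properties of the set of half-edges of the closed walk from \<open>v\<close> back to \<open>v\<close> along an Euler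
  circuit. The pair at \<open>v\<close> joins the half-edge of departure with that of return, so it belongs to the
  \<open>chi\<close> transition; the last clause says that, among the transitions other than \<open>C v\<close>, exactly the one
  labelled \<open>psi\<close> does not contain this pair.
\<close>

definition fundamental_cycle ::
    "('v, 'h) multigraph \<Rightarrow> ('v \<Rightarrow> 'h set set) \<Rightarrow> 'v \<Rightarrow> 'h set \<Rightarrow> bool" where
  "fundamental_cycle F C v X \<longleftrightarrow> mate F ` X \<subseteq> X \<and>
    (\<forall>w. w \<noteq> v \<longrightarrow> (if interlaced F C v w then X \<inter> half_edges_at F w \<in> C w
       else X \<inter> half_edges_at F w = {} \<or> X \<inter> half_edges_at F w = half_edges_at F w)) \<and>
    card (X \<inter> half_edges_at F v) = 2 \<and> X \<inter> half_edges_at F v \<notin> C v \<and>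
    (\<forall>T. is_transition F v T \<and> T \<noteq> C v \<longrightarrow>
       (psi_transition F C v T \<longleftrightarrow> X \<inter> half_edges_at F v \<notin> T))"

lemma euler_system_fundamental_cycle:
  fixes F :: "('v::finite, 'h::finite) multigraph"
  assumes "four_regular F" and "euler_system F C"
  obtains X where "fundamental_cycle F C v X"
proof -
  let ?H = "half_edges_at F" and ?R = "transition_step F C"
  have mg: "is_multigraph F" using assms(1) by (simp add: four_regular_def)
  have cp: "circuit_partition F C" using assms(2) by (simp add: euler_system_def)
  have tr: "is_transition F w (C w)" for w using cp by (simp add: circuit_partition_def)
  have "card (?H v) = 4" using assms(1) by (simp add: four_regular_def)
  then obtain h where "h \<in> ?H v" by (metis card.empty equals0I zero_neq_numeral)
  then have vh: "vert F h = v" by (simp add: half_edges_at_def)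
  obtain c where c: "follows F C (h # c)" "same_circuit F `` {h # c} \<in> circuits F C"
      "h # c \<in> same_circuit F `` {h # c}"
    using euler_circuit_at[OF mg assms(2)] by metis
  define Z where "Z = same_circuit F `` {h # c}"
  have Z: "Z \<in> circuits F C" "h # c \<in> Z" using c by (auto simp: Z_def)
  have ct: "closed_trail F (h # c)" using c(1) by (simp add: follows_def)
  note visits = euler_circuit_visits_twice[OF assms Z ct]
  have vc: "v \<in> vert F ` set (h # c)" using vh by simp
  have "count_list (map (vert F) c) v = Suc 0" using visits(1)[OF vc] vh by simp
  \<comment> \<open>The circuit is \<open>h # a @ g # b\<close>; its two visits to \<open>v\<close> leave along \<open>h\<close> and \<open>g\<close>, and arrive
     along \<open>q\<close> and \<open>p\<close> respectively. The cycle in question is traversed by \<open>h # a\<close>.\<close>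
  then obtain a g b where agb: "c = a @ g # b" "vert F g = v"
      "v \<notin> vert F ` set a" "v \<notin> vert F ` set b"
    by (rule single_visit_split)
  define p q where "p = mate F (last (h # a))" and "q = mate F (last (g # b))"
  have "successively ?R ((h # a) @ g # b)" and qh: "?R (last (g # b)) h"
    using follows_successively[OF c(1)] agb(1) by auto
  then have sa: "successively ?R (h # a)" and sb: "successively ?R (g # b)"
    and pg: "?R (last (h # a)) g"
    by (auto simp: successively_append_iff simp del: append_Cons split: if_splits)
  have pgC: "{p, g} \<in> C v" and qhC: "{q, h} \<in> C v"
    using pg qh agb(2) vh by (auto simp: transition_step_def p_def q_def)
  have vp: "vert F p = v" and vq: "vert F q = v"
    using transition_pair_vert[OF tr pgC] transition_pair_vert[OF tr qhC] by auto
  have inn: "in_half_edges F (h # c) v = {p, q}"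
  proof -
    have "in_half_edges F (h # c) v =
        (mate F ` set (h # a) \<inter> ?H v) \<union> (mate F ` set (g # b) \<inter> ?H v)"
      unfolding in_half_edges_def agb(1) by auto
    then show ?thesis
      unfolding segment_in_half_edges[OF cp sa agb(3)] segment_in_half_edges[OF cp sb agb(4)]
      using vp vq by (auto simp: p_def q_def)
  qed
  have out: "out_half_edges F (h # c) v = {h, g}"
  proof -
    have "vert F x \<noteq> v" if "x \<in> set a \<union> set b" for x using that agb(3,4) by blast
    then show ?thesis using agb(1,2) vh by (auto simp: out_half_edges_def half_edges_at_def)
  qed
  have ne: "p \<noteq> q" "h \<noteq> g" "p \<noteq> h" "p \<noteq> g" "q \<noteq> h" "q \<noteq> g"
    and Hv: "?H v = {p, q, h, g}"
    using visits(2-5)[OF vc] unfolding inn out by (auto simp: card_insert_if split: if_splits)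
  define X where "X = trail_half_edges F (h # a)"
  have XH: "X \<inter> ?H w = (if w = v then {h, p} else {})" if "w \<notin> vert F ` set a" for w
    using segment_half_edges[OF cp sa that] vh vp unfolding X_def p_def by auto
  have Xv: "X \<inter> ?H v = {h, p}" using XH agb(3) by simp
  have Xmate: "mate F ` X \<subseteq> X"
    using mg by (auto simp: X_def trail_half_edges_def is_multigraph_def)
  have Cv: "C v = {{q, h}, {p, g}}"
    using transition_of_pair[OF tr qhC] Hv ne by (auto simp: doubleton_eq_iff)
  have Xchi: "{h, p} \<notin> C v" using Cv ne by (auto simp: doubleton_eq_iff)
  have psi: "psi_transition F C v T \<longleftrightarrow> {h, p} \<notin> T" if T: "is_transition F v T" "T \<noteq> C v" for T
  proof -
    have "psi_transition F C v T \<longleftrightarrow> T = {{p, q}, {h, g}}"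
    proof
      assume "psi_transition F C v T"
      then obtain Z' d where d: "Z' \<in> circuits F C" "v \<in> circuit_verts F Z'" "d \<in> Z'"
          "T = {in_half_edges F d v, out_half_edges F d v}"
        unfolding psi_transition_def by blast
      have "v \<in> circuit_verts F Z" using circuit_verts_eq[OF Z] vc by simp
      then have "Z' = Z" using euler_circuit_unique[OF assms(2) d(1) Z(1) d(2)] by simp
      then have "(h # c, d) \<in> same_circuit F" using d(3) by (simp add: Z_def)
      then show "T = {{p, q}, {h, g}}"
        using same_circuit_in_out[OF mg] d(4) inn out by metis
    next
      assume "T = {{p, q}, {h, g}}"
      then have "T = {in_half_edges F (h # c) v, out_half_edges F (h # c) v}"
        using inn out by simp
      then show "psi_transition F C v T"
        using Z circuit_verts_eq[OF Z] vc unfolding psi_transition_def by blast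
    qed
    moreover have "T = {{p, q}, {h, g}} \<longleftrightarrow> {h, p} \<notin> T"
    proof
      assume "T = {{p, q}, {h, g}}"
      then show "{h, p} \<notin> T" using ne by (auto simp: doubleton_eq_iff)
    next
      assume nT: "{h, p} \<notin> T"
      obtain k where k: "k \<noteq> h" "{h, k} \<in> T"
        using transition_partner[OF T(1) vh] by blast
      have TT: "T = {{h, k}, {p, q, h, g} - {h, k}}"
        using transition_of_pair[OF T(1) k(2)] Hv by simp
      have "k \<in> ?H v" using transition_pair_vert[OF T(1) k(2)] by (simp add: half_edges_at_def)
      then consider "k = q" | "k = g" using k nT Hv by auto
      then show "T = {{p, q}, {h, g}}"
      proof cases
        case 1
        have "{p, q, h, g} - {h, q} = {p, g}" using ne by auto
        then show ?thesis using TT 1 Cv T(2) by (simp add: insert_commute)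
      next
        case 2
        have "{p, q, h, g} - {h, g} = {p, q}" using ne by auto
        then show ?thesis using TT 2 by (simp add: insert_commute)
      qed
    qed
    ultimately show ?thesis by simp
  qed
  have off: "if interlaced F C v w then X \<inter> ?H w \<in> C w else X \<inter> ?H w = {} \<or> X \<inter> ?H w = ?H w"
    if wv: "w \<noteq> v" for w
  proof (cases "w \<in> vert F ` set (h # c)")
    case False
    then have "X \<inter> ?H w = {}" using XH[of w] wv agb(1) by (simp add: image_Un)
    moreover have "\<not> interlaced F C v w"
      using interlaced_imp_alternate(1)[OF assms Z vc wv[symmetric]] False by blast
    ultimately show ?thesis by simp
  next
    case True
    let ?f = "filter (\<lambda>x. x = v \<or> x = w)"
    \<comment> \<open>Either both visits to \<open>w\<close> lie in the same half of the circuit, or one lies in each.\<close>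
    have sum2: "count_list (map (vert F) a) w + count_list (map (vert F) b) w = 2"
      using visits(1)[OF True] agb(1,2) vh wv by auto
    have nint: "\<not> interlaced F C v w" if "\<not> alternate v w (map (vert F) (h # c))"
      using interlaced_imp_alternate(2)[OF assms Z vc wv[symmetric]] that by blast
    have filt: "?f (map (vert F) (h # c)) = v # ?f (map (vert F) a) @ v # ?f (map (vert F) b)"
      using agb(1,2) vh by simp
    have empty: "?f (map (vert F) ys) = []" if "v \<notin> vert F ` set ys" "w \<notin> vert F ` set ys" for ys
      using that by (auto simp: filter_empty_conv)
    consider "count_list (map (vert F) a) w = 0" | "count_list (map (vert F) b) w = 0"
      | "count_list (map (vert F) a) w = Suc 0" "count_list (map (vert F) b) w = Suc 0"
      using sum2 by linarith
    then show ?thesis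
    proof cases
      case 1
      then have wa: "w \<notin> vert F ` set a" by (simp add: count_list_0_iff)
      then have "\<not> alternate v w (map (vert F) (h # c))"
        unfolding alternate_def filt empty[OF agb(3) wa] using wv by simp
      then show ?thesis using nint XH[OF wa] wv by simp
    next
      case 2
      then have wb: "w \<notin> vert F ` set b" by (simp add: count_list_0_iff)
      have "(v # xs @ [v]) \<notin> {[v, w, v, w], [w, v, w, v]}" for xs
        using wv by (auto simp: append_eq_Cons_conv)
      then have "\<not> alternate v w (map (vert F) (h # c))"
        unfolding alternate_def filt empty[OF agb(4) wb] by blast
      moreover have "?H w \<subseteq> X"
      proof -
        have "?H w \<subseteq> trail_half_edges F ((h # a) @ (g # b))"
          using euler_circuit_covers[OF mg assms(2) Z True] agb(1) by simp
        moreover have "trail_half_edges F (g # b) \<inter> ?H w = {}"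
          using segment_half_edges[OF cp sb wb] agb(2) vq wv by (simp add: q_def)
        ultimately show ?thesis unfolding trail_half_edges_append X_def by blast
      qed
      ultimately show ?thesis using nint by auto
    next
      case 3
      obtain r k s where rks: "a = r @ k # s" "vert F k = w" "w \<notin> vert F ` set r" "w \<notin> vert F ` set s"
        using 3(1) by (rule single_visit_split)
      obtain t l u where tlu: "b = t @ l # u" "vert F l = w"
        using 3(2) by (rule single_visit_split)
      let ?j = "Suc (length r)"
      let ?k = "Suc (?j + length s)"
      let ?l = "Suc (?k + length t)"
      have hc: "h # c = (h # r) @ (k # s) @ (g # t) @ l # u" using agb(1) rks(1) tlu(1) by simp
      have "(h # c) ! 0 = h" by simp
      moreover have "(h # c) ! ?j = k" unfolding hc by (simp add: nth_append)
      moreover have "(h # c) ! ?k = g" unfolding hc by (simp add: nth_append)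
      moreover have "(h # c) ! ?l = l" unfolding hc by (simp add: nth_append)
      moreover have "0 < ?j" "?j < ?k" "?k < ?l" by simp_all
      moreover have "?l < length (h # c)" unfolding hc by simp
      ultimately have "interlaced F C v w"
        unfolding interlaced_def using wv Z vh agb(2) rks(2) tlu(2) by metis
      moreover have "X \<inter> ?H w \<in> C w"
      proof -
        have "successively ?R ((h # r) @ k # s)" using sa rks(1) by simp
        then have sr: "successively ?R (h # r)" and ss: "successively ?R (k # s)"
          and rk: "?R (last (h # r)) k"
          by (auto simp: successively_append_iff simp del: append_Cons split: if_splits)
        have "vert F (mate F (last (h # r))) = w" using transition_step_vert[OF cp rk] rks(2) by simp
        moreover have "last (k # s) = last (h # a)" using rks(1) by simp
        moreover have "X = trail_half_edges F (h # r) \<union> trail_half_edges F (k # s)"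
          unfolding X_def trail_half_edges_append[symmetric] using rks(1) by simp
        ultimately have "X \<inter> ?H w = {mate F (last (h # r)), k}"
          using segment_half_edges[OF cp sr rks(3)] segment_half_edges[OF cp ss rks(4)]
            vh vp wv rks(2) by (auto simp: Int_Un_distrib2 p_def)
        then show ?thesis using rk rks(2) by (simp add: transition_step_def)
      qed
      ultimately show ?thesis by simp
    qed
  qed
  have "fundamental_cycle F C v X"
    unfolding fundamental_cycle_def using Xmate off Xv Xchi psi ne by auto
  then show thesis by (rule that)
qed

section \<open>The pairing of half-edge sets at a vertex\<close>

text \<open>
  The parity of the intersection. On the even subsets of the four half-edges at a vertex it is a
  bilinear form whose radical consists of the empty and the full set.
\<close>

definition pairing :: "'a set \<Rightarrow> 'a set \<Rightarrow> bit" where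
  "pairing A B = of_nat (card (A \<inter> B))"

lemma pairing_commute: "pairing A B = pairing B A"
  by (simp add: pairing_def Int_commute)

lemma of_nat_bit_eq_0_iff: "(of_nat n :: bit) = 0 \<longleftrightarrow> even n"
  by (cases "even n") (auto simp: of_nat_mult elim!: evenE oddE)

lemma pairing_eq_0_iff: "pairing A B = 0 \<longleftrightarrow> even (card (A \<inter> B))"
  by (simp add: pairing_def of_nat_bit_eq_0_iff)

lemma bit_eqI: "(a = 0 \<longleftrightarrow> b = 0) \<Longrightarrow> a = b" for a b :: bit
  by (cases a; cases b) auto

lemma pairing_complement:
  assumes "finite H" and "B \<subseteq> H" and "even (card B)"
  shows "pairing (H - A) B = pairing A B"
proof -
  have "card B = card ((H - A) \<inter> B) + card (A \<inter> B)"
    using assms(1,2) by (subst card_Un_disjoint[symmetric]) (auto intro!: arg_cong[of _ _ card] intro: finite_subset)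
  then have "even (card ((H - A) \<inter> B)) \<longleftrightarrow> even (card (A \<inter> B))"
    using assms(3) by presburger
  then show ?thesis by (intro bit_eqI) (simp add: pairing_eq_0_iff)
qed

text \<open>
  The pairs in a four-element set fall into three classes, each consisting of a pair and its
  complement; two pairs have pairing zero if and only if they are in the same class.
\<close>

lemma pair_classes:
  fixes H :: "'a set"
  assumes "card H = 4"
  shows "\<exists>r :: 'a set \<Rightarrow> nat. \<forall>A B. A \<subseteq> H \<longrightarrow> card A = 2 \<longrightarrow> B \<subseteq> H \<longrightarrow> card B = 2 \<longrightarrow>
    r A < 3 \<and> pairing A B = of_bool (r A \<noteq> r B) \<and> (r A = r B \<longleftrightarrow> A = B \<or> A = H - B)"
proof -
  obtain a b c d where H: "H = {a, b, c, d}" and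
    ne: "a \<noteq> b" "a \<noteq> c" "a \<noteq> d" "b \<noteq> c" "b \<noteq> d" "c \<noteq> d"
    using assms by (auto simp: numeral_eq_Suc card_Suc_eq)
  define r where "r A = (if A = {a, b} \<or> A = {c, d} then 0
    else if A = {a, c} \<or> A = {b, d} then 1 else 2 :: nat)" for A
  have pairs: "A = {a, b} \<or> A = {c, d} \<or> A = {a, c} \<or> A = {b, d} \<or> A = {a, d} \<or> A = {b, c}"
    if A: "A \<subseteq> H" "card A = 2" for A
  proof -
    obtain x y where "A = {x, y}" "x \<noteq> y" using A(2) by (meson card_2_iff)
    then show ?thesis using A(1) unfolding H by (auto simp: doubleton_eq_iff)
  qed
  have dbl: "{x, y} = {z, w} \<longleftrightarrow> x = z \<and> y = w \<or> x = w \<and> y = z" for x y z w :: 'a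
    by (rule doubleton_eq_iff)
  have r: "r {a, b} = 0" "r {c, d} = 0" "r {a, c} = 1" "r {b, d} = 1" "r {a, d} = 2" "r {b, c} = 2"
    using ne by (auto simp: r_def dbl)
  have diff: "H - {a, b} = {c, d}" "H - {c, d} = {a, b}" "H - {a, c} = {b, d}"
    "H - {b, d} = {a, c}" "H - {a, d} = {b, c}" "H - {b, c} = {a, d}"
    using ne unfolding H by auto
  show ?thesis
  proof (intro exI[of _ r] allI impI)
    fix A B assume "A \<subseteq> H" "card A = 2" "B \<subseteq> H" "card B = 2"
    note A = pairs[OF this(1,2)] and B = pairs[OF this(3,4)]
    have "r A < 3" by (simp add: r_def)
    moreover have "pairing A B = of_bool (r A \<noteq> r B)"
      using A B by (elim disjE) (simp_all add: pairing_def r ne ne[symmetric])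
    moreover have "r A = r B \<longleftrightarrow> A = B \<or> A = H - B"
      using A B by (elim disjE) (simp_all add: diff r dbl ne ne[symmetric])
    ultimately show "r A < 3 \<and> pairing A B = of_bool (r A \<noteq> r B) \<and>
        (r A = r B \<longleftrightarrow> A = B \<or> A = H - B)" by blast
  qed
qed

lemma pairing_transition_eq_0_iff:
  assumes "four_regular F" and "is_transition F v T" and "p \<in> T"
    and "A \<subseteq> half_edges_at F v" and "card A = 2"
  shows "pairing A p = 0 \<longleftrightarrow> A \<in> T"
proof -
  have H: "card (half_edges_at F v) = 4" using assms(1) by (simp add: four_regular_def)
  obtain q r where T: "T = {q, r}" "q \<inter> r = {}" "q \<union> r = half_edges_at F v" "card q = 2" "card r = 2"
    using assms(2) unfolding is_transition_def by blast
  have p: "p \<subseteq> half_edges_at F v" "card p = 2" using T assms(3) by auto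
  have "half_edges_at F v - q = r" "half_edges_at F v - r = q" using T(2,3) by auto
  then have "A \<in> T \<longleftrightarrow> A = p \<or> A = half_edges_at F v - p" using assms(3) T(1) by auto
  moreover have "pairing A p = 0 \<longleftrightarrow> A = p \<or> A = half_edges_at F v - p"
    using pair_classes[OF H] assms(4,5) p by (elim exE) simp
  ultimately show ?thesis by simp
qed

text \<open>
  The Pluecker relation \<open>\<langle>p, q\<rangle>\<langle>x, y\<rangle> + \<langle>x, q\<rangle>\<langle>p, y\<rangle> = \<langle>p, x\<rangle>\<langle>q, y\<rangle>\<close> in a symplectic plane over the
  field with two elements, in the case where the right-hand side is 1.
\<close>

lemma pairing_pluecker:
  assumes "card H = 4"
    and "p \<subseteq> H" "card p = 2" "x \<subseteq> H" "card x = 2" "q \<subseteq> H" "card q = 2" "y \<subseteq> H" "card y = 2"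
    and "pairing p x = 1" and "pairing q y = 1"
  shows "pairing p q * pairing x y + pairing x q * pairing p y = 1"
proof -
  obtain r :: "'a set \<Rightarrow> nat" where
    r: "\<forall>A B. A \<subseteq> H \<longrightarrow> card A = 2 \<longrightarrow> B \<subseteq> H \<longrightarrow> card B = 2 \<longrightarrow>
      r A < 3 \<and> pairing A B = of_bool (r A \<noteq> r B) \<and> (r A = r B \<longleftrightarrow> A = B \<or> A = H - B)"
    using pair_classes[OF assms(1)] ..
  then have r3: "\<And>A. A \<subseteq> H \<Longrightarrow> card A = 2 \<Longrightarrow> r A < 3"
    and rp: "\<And>A B. A \<subseteq> H \<Longrightarrow> card A = 2 \<Longrightarrow> B \<subseteq> H \<Longrightarrow> card B = 2 \<Longrightarrow>
      pairing A B = of_bool (r A \<noteq> r B)"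
    by simp_all
  have lt: "r p < 3" "r x < 3" "r q < 3" "r y < 3" using r3 assms(2-9) by auto
  have "r p \<noteq> r x" "r q \<noteq> r y"
    using rp[of p x] rp[of q y] assms(2-11) by auto
  then have "(r p \<noteq> r q \<and> r x \<noteq> r y) \<noteq> (r x \<noteq> r q \<and> r p \<noteq> r y)" using lt by linarith
  then show ?thesis
    using rp[of p q] rp[of x y] rp[of x q] rp[of p y] assms(2-9) by auto
qed

text \<open>
  A set of half-edges closed under \<open>mate\<close> is a disjoint union of edges, so it has even cardinality.
\<close>

lemma even_card_mate_closed:
  fixes F :: "('v::finite, 'h::finite) multigraph"
  assumes "is_multigraph F" and "mate F ` S \<subseteq> S"
  shows "even (card S)"
proof -
  have mm: "mate F (mate F h) = h" "mate F h \<noteq> h" for h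
    using assms(1) by (auto simp: is_multigraph_def)
  have U: "\<Union> (full_edge F ` S) = S" using assms(2) by (auto simp: full_edge_def)
  have "2 * card (full_edge F ` S) = card (\<Union> (full_edge F ` S))"
  proof (rule card_partition)
    fix c assume "c \<in> full_edge F ` S"
    then obtain h where "c = {h, mate F h}" by (auto simp: full_edge_def)
    then show "card c = 2" using mm(2)[of h] by (simp add: card_insert_if)
  next
    fix c d assume "c \<in> full_edge F ` S" "d \<in> full_edge F ` S" "c \<noteq> d"
    then obtain h k where "c = {h, mate F h}" "d = {k, mate F k}" by (auto simp: full_edge_def)
    then show "c \<inter> d = {}" using mm \<open>c \<noteq> d\<close> by auto (metis insert_commute mm(1))+
  qed simp_all
  then show ?thesis using U by (metis dvd_triv_left)
qed

text \<open>Two cycles are orthogonal: their intersection is a union of edges.\<close>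

lemma sum_pairing_mate_closed:
  fixes F :: "('v::finite, 'h::finite) multigraph"
  assumes "is_multigraph F" and "mate F ` A \<subseteq> A" and "mate F ` B \<subseteq> B"
  shows "(\<Sum>v\<in>UNIV. pairing (A \<inter> half_edges_at F v) (B \<inter> half_edges_at F v)) = 0"
proof -
  have "even (card (A \<inter> B))" using assms by (intro even_card_mate_closed) auto
  moreover have "card (A \<inter> B) =
      (\<Sum>v\<in>UNIV. card ((A \<inter> half_edges_at F v) \<inter> (B \<inter> half_edges_at F v)))"
    by (subst card_UN_disjoint[symmetric]) (auto simp: half_edges_at_def intro!: arg_cong[of _ _ card])
  ultimately have "(of_nat (\<Sum>v\<in>UNIV. card ((A \<inter> half_edges_at F v) \<inter> (B \<inter> half_edges_at F v))) :: bit) = 0"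
    by (simp only: of_nat_bit_eq_0_iff)
  then show ?thesis by (simp add: pairing_def)
qed

section \<open>Inverting the relative interlacement matrix\<close>

text \<open>
  A choice of a fundamental cycle \<open>X v\<close> and of one of the two pairs \<open>p v\<close> of the transition \<open>C v\<close> for
  every vertex \<open>v\<close>. Such a choice is possible if \<open>C\<close> is an Euler system.
\<close>

locale euler_cycle_basis =
  fixes F :: "('v::finite, 'h::finite) multigraph" and C :: "'v \<Rightarrow> 'h set set"
    and X p :: "'v \<Rightarrow> 'h set"
  assumes four_regular: "four_regular F"
    and partition: "circuit_partition F C"
    and cycle: "fundamental_cycle F C v (X v)"
    and pair_in: "p v \<in> C v"
begin

lemma mate_closed: "mate F ` X v \<subseteq> X v"
  and at_base: "card (X v \<inter> half_edges_at F v) = 2"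
  and base_notin: "X v \<inter> half_edges_at F v \<notin> C v"
  and off_base: "w \<noteq> v \<Longrightarrow> if interlaced F C v w then X v \<inter> half_edges_at F w \<in> C w
    else X v \<inter> half_edges_at F w = {} \<or> X v \<inter> half_edges_at F w = half_edges_at F w"
  and psi_iff: "is_transition F v T \<Longrightarrow> T \<noteq> C v \<Longrightarrow>
    psi_transition F C v T \<longleftrightarrow> X v \<inter> half_edges_at F v \<notin> T"
  using cycle[of v] unfolding fundamental_cycle_def by blast+


text \<open>The pair of half-edges at \<open>v\<close> in the cycle \<open>X v\<close>.\<close>

abbreviation "base v \<equiv> X v \<inter> half_edges_at F v"

abbreviation "I \<equiv> interlacement_matrix F C"

lemma card_half_edges: "card (half_edges_at F v) = 4"
  using four_regular by (simp add: four_regular_def)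

lemma multigraph: "is_multigraph F"
  using four_regular by (simp add: four_regular_def)

lemma transition: "is_transition F v (C v)"
  using partition by (simp add: circuit_partition_def)

lemma transition_pair:
  assumes "q \<in> C v"
  shows "q \<subseteq> half_edges_at F v" and "card q = 2"
  using transition[of v] assms unfolding is_transition_def by auto

lemma pairing_p_base: "pairing (p v) (base v) = 1"
proof -
  have "pairing (base v) (p v) \<noteq> 0"
    using pairing_transition_eq_0_iff[OF four_regular transition pair_in] at_base base_notin by simp
  then show ?thesis by (simp add: pairing_commute)
qed

lemma even_card_cycle: "even (card (X v \<inter> half_edges_at F w))"
proof (cases "w = v")
  case False
  then show ?thesis using off_base[OF False] transition_pair(2) card_half_edges
    by (auto split: if_splits)
qed (simp add: at_base)

text \<open>
  Up to complements, which the pairing with even sets ignores, \<open>X v\<close> is \<open>I v w\<close> times the transition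
  \<open>C w\<close> at every vertex \<open>w\<close> other than \<open>v\<close>.
\<close>

lemma pairing_off_base:
  assumes "w \<noteq> v" and "B \<subseteq> half_edges_at F w" and "even (card B)"
  shows "pairing (X v \<inter> half_edges_at F w) B = I $ v $ w * pairing (p w) B"
proof (cases "interlaced F C v w")
  case True
  have C: "C w = {p w, half_edges_at F w - p w}"
    by (rule transition_of_pair[OF transition pair_in])
  have "X v \<inter> half_edges_at F w \<in> C w" using off_base[OF assms(1)] True by simp
  then have "X v \<inter> half_edges_at F w = p w \<or> X v \<inter> half_edges_at F w = half_edges_at F w - p w"
    unfolding C by simp
  then have "pairing (X v \<inter> half_edges_at F w) B = pairing (p w) B"
    using pairing_complement[OF _ assms(2,3)] by auto
  then show ?thesis using True by (simp add: interlacement_matrix_def)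
next
  case False
  then have "X v \<inter> half_edges_at F w = {} \<or> X v \<inter> half_edges_at F w = half_edges_at F w"
    using off_base[OF assms(1)] by simp
  then have "even (card (X v \<inter> half_edges_at F w \<inter> B))"
    using assms(2,3) by (metis Int_absorb1 Int_empty_left card.empty dvd_0_right)
  then show ?thesis using False by (simp add: interlacement_matrix_def pairing_eq_0_iff)
qed

lemma I_diagonal: "I $ v $ v = 0"
  by (simp add: interlacement_matrix_def interlaced_def)

text \<open>
  The entries in terms of the pairing, where \<open>q v\<close> is one of the two pairs of \<open>P v\<close>:
  \<open>pairing (p v) (q v)\<close> vanishes exactly at the vertices where \<open>P\<close> involves the \<open>phi\<close> transition, and
  \<open>pairing (base v) (q v)\<close> exactly at those where it involves the \<open>chi\<close> transition.
\<close>

lemma relative_interlacement_matrix_entry: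
  assumes "circuit_partition F P" and "\<And>v. q v \<in> P v"
  shows "relative_interlacement_matrix F P C $ v $ w =
    (if v = w then pairing (base v) (q v) else 0) +
    pairing (p v) (q v) * pairing (p w) (q w) * I $ v $ w"
proof -
  have tr: "is_transition F u (P u)" for u using assms(1) by (simp add: circuit_partition_def)
  have phi: "phi_transition F C u (P u) \<longleftrightarrow> pairing (p u) (q u) = 0" for u
  proof -
    have "pairing (p u) (q u) = 0 \<longleftrightarrow> p u \<in> P u"
      by (rule pairing_transition_eq_0_iff[OF four_regular tr assms(2) transition_pair[OF pair_in]])
    also have "\<dots> \<longleftrightarrow> P u = C u"
      using transition_of_pair[OF tr] transition_of_pair[OF transition pair_in] pair_in by metis
    finally show ?thesis by (simp add: phi_transition_def)
  qed
  have "pairing (base v) (q v) = 0 \<longleftrightarrow> base v \<in> P v"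
    by (rule pairing_transition_eq_0_iff[OF four_regular tr assms(2) _ at_base]) simp
  also have "\<dots> \<longleftrightarrow> \<not> (phi_transition F C v (P v) \<or> psi_transition F C v (P v))"
    using psi_iff[OF tr] base_notin unfolding phi_transition_def by metis
  finally have "pairing (base v) (q v) = 0 \<longleftrightarrow>
      \<not> (phi_transition F C v (P v) \<or> psi_transition F C v (P v))" .
  then show ?thesis
    unfolding relative_interlacement_matrix_def using phi I_diagonal by auto
qed

end

lemma euler_cycle_basis_exists:
  fixes F :: "('v::finite, 'h::finite) multigraph"
  assumes "four_regular F" and "euler_system F C"
  obtains X p where "euler_cycle_basis F C X p"
proof -
  have cp: "circuit_partition F C" using assms(2) by (simp add: euler_system_def)
  have "\<exists>p. \<forall>v. p v \<in> C v"
    using cp unfolding circuit_partition_def is_transition_def by (intro choice) blast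
  then obtain p where p: "\<And>v. p v \<in> C v" by blast
  have "\<exists>X. \<forall>v. fundamental_cycle F C v (X v)"
    using euler_system_fundamental_cycle[OF assms] by (intro choice allI) metis
  then obtain X where "\<And>v. fundamental_cycle F C v (X v)" by blast
  then have "euler_cycle_basis F C X p"
    using assms(1) cp p by unfold_locales
  then show thesis by (rule that)
qed

text \<open>Orthogonality of two fundamental cycles, in coordinates.\<close>

lemma euler_cycle_bases_orthogonal:
  fixes F :: "('v::finite, 'h::finite) multigraph"
  assumes "euler_cycle_basis F C X p" and "euler_cycle_basis F C' Y q"
  defines "A \<equiv> interlacement_matrix F C" and "B \<equiv> interlacement_matrix F C'"
  shows "(\<Sum>w\<in>UNIV. A $ v $ w * B $ u $ w * pairing (p w) (q w)) +
    A $ v $ u * pairing (p u) (Y u \<inter> half_edges_at F u) +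
    B $ u $ v * pairing (X v \<inter> half_edges_at F v) (q v) +
    (if v = u then pairing (X v \<inter> half_edges_at F v) (Y v \<inter> half_edges_at F v) else 0) = 0"
proof -
  interpret C: euler_cycle_basis F C X p by fact
  interpret C': euler_cycle_basis F C' Y q by fact
  let ?H = "half_edges_at F"
  have entry: "pairing (X v \<inter> ?H w) (Y u \<inter> ?H w) =
      A $ v $ w * B $ u $ w * pairing (p w) (q w) +
      (if w = u then A $ v $ u * pairing (p u) (Y u \<inter> ?H u) else 0) +
      (if w = v then B $ u $ v * pairing (X v \<inter> ?H v) (q v) else 0) +
      (if w = v then if v = u then pairing (X v \<inter> ?H v) (Y v \<inter> ?H v) else 0 else 0)" for w
  proof -
    have off_v: "pairing (X v \<inter> ?H w) D = A $ v $ w * pairing (p w) D"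
      if "w \<noteq> v" "D \<subseteq> ?H w" "even (card D)" for D
      using C.pairing_off_base[OF that] by (simp add: A_def)
    have off_u: "pairing D (Y u \<inter> ?H w) = B $ u $ w * pairing D (q w)"
      if "w \<noteq> u" "D \<subseteq> ?H w" "even (card D)" for D
      using C'.pairing_off_base[OF that] by (simp add: B_def pairing_commute)
    have diag: "A $ w $ w = 0" "B $ w $ w = 0"
      by (simp_all add: A_def B_def C.I_diagonal C'.I_diagonal)
    have p: "p w \<subseteq> ?H w" "even (card (p w))"
      using C.transition_pair[OF C.pair_in] by simp_all
    consider "w = v" "w = u" | "w = v" "w \<noteq> u" | "w \<noteq> v" "w = u" | "w \<noteq> v" "w \<noteq> u" by blast
    then show ?thesis
    proof cases
      case 1
      then show ?thesis using diag by simp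
    next
      case 2
      then show ?thesis using diag off_u[of "X v \<inter> ?H w"] C.even_card_cycle by simp
    next
      case 3
      then show ?thesis using diag off_v[of "Y u \<inter> ?H w"] C'.even_card_cycle by simp
    next
      case 4
      then show ?thesis using off_v[of "Y u \<inter> ?H w"] C'.even_card_cycle off_u[of "p w"] p by simp
    qed
  qed
  have "(\<Sum>w\<in>UNIV. pairing (X v \<inter> ?H w) (Y u \<inter> ?H w)) = 0"
    by (rule sum_pairing_mate_closed[OF C.multigraph C.mate_closed C'.mate_closed])
  then show ?thesis unfolding entry sum.distrib by simp
qed

text \<open>This is the orthogonality of the cycles \<open>X v\<close> and \<open>X w\<close> of a single Euler system.\<close>

lemma interlacement_matrix_symmetric:
  fixes F :: "('v::finite, 'h::finite) multigraph"
  assumes "euler_cycle_basis F C X p"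
  shows "interlacement_matrix F C $ v $ w = interlacement_matrix F C $ w $ v"
proof (cases "v = w")
  case False
  interpret euler_cycle_basis F C X p by fact
  have "pairing (p u) (p u) = 0" for u
    using transition_pair[OF pair_in] by (simp add: pairing_eq_0_iff)
  moreover have "pairing (base u) (p u) = 1" for u
    using pairing_p_base by (simp add: pairing_commute)
  ultimately have "I $ v $ w + I $ w $ v = 0"
    using euler_cycle_bases_orthogonal[OF assms assms, of v w] False pairing_p_base by simp
  then show ?thesis by (cases "I $ v $ w"; cases "I $ w $ v") auto
qed simp

lemma relative_interlacement_matrix_mult:
  fixes F :: "('v::finite, 'h::finite) multigraph"
  assumes "four_regular F" and "euler_system F C" and "euler_system F C'"
  shows "relative_interlacement_matrix F C' C ** relative_interlacement_matrix F C C' = mat 1"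
proof -
  obtain X p where "euler_cycle_basis F C X p"
    using euler_cycle_basis_exists[OF assms(1,2)] .
  then interpret C: euler_cycle_basis F C X p .
  obtain Y q where "euler_cycle_basis F C' Y q"
    using euler_cycle_basis_exists[OF assms(1,3)] .
  then interpret C': euler_cycle_basis F C' Y q .
  let ?M = "relative_interlacement_matrix F C' C" and ?M' = "relative_interlacement_matrix F C C'"
  define A B where "A = interlacement_matrix F C" and "B = interlacement_matrix F C'"
  define d e f g where "d v = pairing (p v) (q v)" and "e v = pairing (C.base v) (q v)"
    and "f v = pairing (p v) (C'.base v)" and "g v = pairing (C.base v) (C'.base v)" for v
  have M: "?M $ v $ w = (if v = w then e v else 0) + d v * d w * A $ v $ w" for v w
    using C.relative_interlacement_matrix_entry[OF C'.partition C'.pair_in]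
    by (simp add: d_def e_def A_def)
  have M': "?M' $ w $ u = (if w = u then f w else 0) + d w * d u * B $ u $ w" for w u
    using C'.relative_interlacement_matrix_entry[OF C.partition C.pair_in]
      interlacement_matrix_symmetric[OF C'.euler_cycle_basis_axioms]
    by (simp add: d_def f_def B_def pairing_commute)
  have orth: "(\<Sum>w\<in>UNIV. A $ v $ w * B $ u $ w * d w) + A $ v $ u * f u + B $ u $ v * e v +
      (if v = u then g v else 0) = 0" for v u
    using euler_cycle_bases_orthogonal[OF C.euler_cycle_basis_axioms C'.euler_cycle_basis_axioms]
    by (simp add: A_def B_def d_def e_def f_def g_def)
  have pluecker: "d v * g v + e v * f v = 1" for v
    unfolding d_def e_def f_def g_def
    by (rule pairing_pluecker[OF C.card_half_edges C.transition_pair[OF C.pair_in] _ C.at_base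
          C'.transition_pair[OF C'.pair_in] _ C'.at_base C.pairing_p_base C'.pairing_p_base]) simp_all
  have idem: "x * x = x" for x :: bit by (cases x) auto
  have sum_0: "x + y = 0 \<Longrightarrow> x = y" for x y :: bit by (cases x; cases y) auto
  have "(?M ** ?M') $ v $ u = mat 1 $ v $ u" for v u
  proof -
    have "(?M ** ?M') $ v $ u = (\<Sum>w\<in>UNIV. ?M $ v $ w * ?M' $ w $ u)"
      by (simp add: matrix_matrix_mult_def)
    also have "\<dots> = (\<Sum>w\<in>UNIV. d v * d u * (A $ v $ w * B $ u $ w * d w) +
        (if w = u then d v * d u * (A $ v $ u * f u) else 0) +
        (if w = v then d v * d u * (B $ u $ v * e v) else 0) +
        (if w = v then if v = u then e v * f v else 0 else 0))"
    proof (rule sum.cong[OF refl])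
      fix w
      have "d v * d w * A $ v $ w * (d w * d u * B $ u $ w) =
          d v * d u * (A $ v $ w * B $ u $ w * (d w * d w))" by (simp add: algebra_simps)
      then have "d v * d w * A $ v $ w * (d w * d u * B $ u $ w) =
          d v * d u * (A $ v $ w * B $ u $ w * d w)" by (simp only: idem)
      moreover have "?M $ v $ w * ?M' $ w $ u =
          d v * d w * A $ v $ w * (d w * d u * B $ u $ w) +
          d v * d w * A $ v $ w * (if w = u then f w else 0) +
          (if v = w then e v else 0) * (d w * d u * B $ u $ w) +
          (if v = w then e v else 0) * (if w = u then f w else 0)"
        unfolding M M' by (simp only: distrib_left distrib_right ac_simps)
      ultimately show "?M $ v $ w * ?M' $ w $ u = d v * d u * (A $ v $ w * B $ u $ w * d w) +
        (if w = u then d v * d u * (A $ v $ u * f u) else 0) +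
        (if w = v then d v * d u * (B $ u $ v * e v) else 0) +
        (if w = v then if v = u then e v * f v else 0 else 0)"
        by (simp add: ac_simps)
    qed
    also have "\<dots> = d v * d u * ((\<Sum>w\<in>UNIV. A $ v $ w * B $ u $ w * d w) +
        A $ v $ u * f u + B $ u $ v * e v) + (if v = u then e v * f v else 0)"
      unfolding sum.distrib sum_distrib_left[symmetric]
      by (simp only: sum.delta finite UNIV_I if_True distrib_left)
    also have "(\<Sum>w\<in>UNIV. A $ v $ w * B $ u $ w * d w) + A $ v $ u * f u + B $ u $ v * e v =
        (if v = u then g v else 0)"
      by (rule sum_0 [OF orth])
    also have "d v * d u * (if v = u then g v else 0) + (if v = u then e v * f v else 0) =
        (if v = u then 1 else 0)"
      using pluecker[of v] idem[of "d v"] by (cases "v = u") simp_all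
    finally show ?thesis by (simp add: mat_def)
  qed
  then show ?thesis by (simp add: vec_eq_iff)
qed

theorem theorem17:
  fixes F :: "('v::finite, 'h::finite) multigraph"
    and C C' :: "'v \<Rightarrow> 'h set set"
  assumes "four_regular F"
    and "euler_system F C"
    and "euler_system F C'"
  shows "invertible (relative_interlacement_matrix F C' C) \<and>
         matrix_inv (relative_interlacement_matrix F C' C) = relative_interlacement_matrix F C C'"
proof
  let ?M = "relative_interlacement_matrix F C' C" and ?M' = "relative_interlacement_matrix F C C'"
  have 1: "?M ** ?M' = mat 1" and 2: "?M' ** ?M = mat 1"
    using relative_interlacement_matrix_mult assms by auto
  then show inv: "invertible ?M" unfolding invertible_def by blast
  have "matrix_inv ?M ** ?M = mat 1"
    using someI_ex[OF inv[unfolded invertible_def]] unfolding matrix_inv_def by blast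
  then have "matrix_inv ?M ** (?M ** ?M') = ?M'"
    by (simp add: matrix_mul_assoc)
  then show "matrix_inv ?M = ?M'" using 1 by simp
qed

end
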